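(* For all $m,k\in\mathbb{N}$, $$\sum_{n=1}^\infty\frac{4^n}{\binom{2n}{n}}\frac{\zeta_{n-1}(1_{m-1})t^\star_n(1_k)}{n^2}=\sum_{n=1}^\infty\frac{1}{4^n}\binom{2n}{n}\frac{t_n(1_k)\zeta^\star_n(1_m)}{n}=\binom{m+k}{k}\frac{2^{m+k+1}-1}{2^k}\zeta(m+k+1).$$ Moreover, for $m=0$ and $k\in\mathbb{N}$ the second equality also holds: $\sum_{n=1}^\infty\frac{1}{4^n}\binom{2n}{n}\frac{t_n(1_k)}{n}=\frac{2^{k+1}-1}{2^k}\zeta(k+1)$.
   Context: For $n\in\mathbb{N}_0$: $\zeta_n(1_d)=\sum_{n\ge n_1>\cdots>n_d>0}\prod n_j^{-1}$, $\zeta^\star_n(1_d)=\sum_{n\ge n_1\ge\cdots\ge n_d>0}\prod n_j^{-1}$, $t_n(1_d)=\sum_{n\ge n_1>\cdots>n_d>0}\prod(2n_j-1)^{-1}$, $t^\star_n(1_d)=\sum_{n\ge n_1\ge\cdots\ge n_d>0}\prod(2n_j-1)^{-1}$, all equal to $1$ for $d=0$; $1_d$ is the string of $d$ ones. *)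

theory Defs
  imports "HOL-Analysis.Analysis"
begin

definition strict_indices :: "nat \<Rightarrow> nat \<Rightarrow> nat list set" where
  "strict_indices n d = {ns. length ns = d \<and> sorted_wrt (>) ns \<and> set ns \<subseteq> {1..n}}"

definition weak_indices :: "nat \<Rightarrow> nat \<Rightarrow> nat list set" where
  "weak_indices n d = {ns. length ns = d \<and> sorted_wrt (\<ge>) ns \<and> set ns \<subseteq> {1..n}}"

text \<open>
  In the next four definitions the second argument \<open>d\<close> is the depth: the sums are those at the
  string \<open>1_d\<close> of \<open>d\<close> ones.
\<close>

definition zeta_trunc :: "nat \<Rightarrow> nat \<Rightarrow> real" where
  "zeta_trunc n d = (\<Sum>ns\<in>strict_indices n d. \<Prod>j\<leftarrow>ns. 1 / real j)"

definition zeta_star_trunc :: "nat \<Rightarrow> nat \<Rightarrow> real" where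
  "zeta_star_trunc n d = (\<Sum>ns\<in>weak_indices n d. \<Prod>j\<leftarrow>ns. 1 / real j)"

definition t_trunc :: "nat \<Rightarrow> nat \<Rightarrow> real" where
  "t_trunc n d = (\<Sum>ns\<in>strict_indices n d. \<Prod>j\<leftarrow>ns. 1 / (2 * real j - 1))"

definition t_star_trunc :: "nat \<Rightarrow> nat \<Rightarrow> real" where
  "t_star_trunc n d = (\<Sum>ns\<in>weak_indices n d. \<Prod>j\<leftarrow>ns. 1 / (2 * real j - 1))"

text \<open>
  The Riemann zeta function at integer arguments \<open>s \<ge> 2\<close>; for \<open>s < 2\<close> the series diverges and the
  value is meaningless.
\<close>

definition zeta :: "nat \<Rightarrow> real" where
  "zeta s = (\<Sum>n. 1 / real (Suc n) ^ s)"

lemma finite_strict_indices: "finite (strict_indices n d)"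
  by (rule finite_subset[OF _ finite_lists_length_eq[of "{1..n}" d]])
    (auto simp: strict_indices_def)

lemma finite_weak_indices: "finite (weak_indices n d)"
  by (rule finite_subset[OF _ finite_lists_length_eq[of "{1..n}" d]])
    (auto simp: weak_indices_def)

lemma strict_indices_0: "strict_indices n 0 = {[]}"
  by (auto simp: strict_indices_def)

lemma weak_indices_0: "weak_indices n 0 = {[]}"
  by (auto simp: weak_indices_def)

lemma trunc_0 [simp]:
  "zeta_trunc n 0 = 1" "zeta_star_trunc n 0 = 1" "t_trunc n 0 = 1" "t_star_trunc n 0 = 1"
  by (simp_all add: zeta_trunc_def zeta_star_trunc_def t_trunc_def t_star_trunc_def
      strict_indices_0 weak_indices_0)

lemma zeta_sums:
  assumes "s \<ge> 2"
  shows "(\<lambda>n. 1 / real (Suc n) ^ s) sums zeta s"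
proof -
  have "summable (\<lambda>n. inverse (real n ^ s))"
    using inverse_power_summable[OF assms, where 'a = real] by simp
  then have "summable (\<lambda>n. 1 / real (Suc n) ^ s)"
    by (subst (asm) summable_Suc_iff[symmetric]) (simp add: inverse_eq_divide)
  then show ?thesis
    unfolding zeta_def by (rule summable_sums)
qed

end

theory Submission
  imports Defs
begin

text \<open>
  For \<open>0 < a < c\<close>, exchanging the order of summation in \<open>\<Sum>N\<ge>0. \<Sum>n\<ge>1. (a)\<^sub>n / (c + N)\<^sub>n\<^sub>+\<^sub>1\<close> gives
  \<open>(\<Sum>n\<ge>1. (a)\<^sub>n / (n (c)\<^sub>n)) = (\<Sum>N\<ge>0. 1 / (c + N - a) - 1 / (c + N))\<close>.
  With \<open>a = x\<close>, \<open>c = (1 - y) / 2\<close> the left-hand side is \<open>x\<close> times the generating function (in \<open>m - 1\<close> and \<open>k\<close>)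
  of the first series, and with \<open>a = (1 + y) / 2\<close>, \<open>c = 1 - x\<close> it is the generating function of the
  second. All coefficients in \<open>x\<close> and \<open>y\<close> are nonnegative on both sides, so they can be compared
  one variable at a time; on the right the negative binomial series leaves sums over odd integers,
  which are multiples of zeta values.
\<close>

subsection \<open>Series with nonnegative coefficients\<close>

text \<open>Nonnegativity turns \<open>sums\<close> into the unconditional \<open>has_sum\<close>,
  for which double sums may be swapped. Convergence of the columns is a separate conclusion, since
  \<open>suminf\<close> of a divergent series would be an arbitrary value.\<close>

lemma tonelli_sums:
  fixes a :: "nat \<Rightarrow> nat \<Rightarrow> real"
  assumes nonneg: "\<And>n i. 0 \<le> a n i"
    and rows: "\<And>n. a n sums r n"
    and total: "r sums S"
  shows "\<And>i. summable (\<lambda>n. a n i)" and "(\<lambda>i. \<Sum>n. a n i) sums S"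
proof -
  have r0: "0 \<le> r n" for n
    using rows[of n] nonneg[of n] by (metis sums_le sums_zero)
  have r: "(r has_sum S) UNIV"
    by (rule sums_nonneg_imp_has_sum[OF total r0])
  have row: "((\<lambda>i. a n i) has_sum r n) UNIV" for n
    by (rule sums_nonneg_imp_has_sum[OF rows nonneg])
  have "(\<lambda>(n, i). a n i) summable_on UNIV \<times> UNIV"
    by (rule summable_on_SigmaI[where g = r]) (use row r nonneg in \<open>auto simp: summable_on_def\<close>)
  then have "((\<lambda>(n, i). a n i) has_sum S) (UNIV \<times> UNIV)"
    by (intro has_sum_SigmaI[where g = r]) (use row r in auto)
  then have sw: "((\<lambda>(i, n). a n i) has_sum S) (UNIV \<times> UNIV)"
    by (subst has_sum_swap) simp
  then have "(\<lambda>(i, n). a n i) summable_on UNIV \<times> UNIV"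
    by (auto simp: summable_on_def)
  then have col: "(\<lambda>n. a n i) summable_on UNIV" for i
    by (rule summable_on_SigmaD1) simp
  then show summ: "summable (\<lambda>n. a n i)" for i
    by (rule summable_on_imp_summable)
  have "((\<lambda>n. a n i) has_sum (\<Sum>n. a n i)) UNIV" for i
    by (rule sums_nonneg_imp_has_sum[OF summable_sums[OF summ] nonneg])
  with sw have "((\<lambda>i. \<Sum>n. a n i) has_sum S) UNIV"
    by (intro has_sum_SigmaD[OF sw]) auto
  then show "(\<lambda>i. \<Sum>n. a n i) sums S"
    by (rule has_sum_imp_sums)
qed

text \<open>Once the lower coefficients vanish, dividing by \<open>x ^ i\<close> leaves a power
  series with constant term \<open>d i\<close>. It is continuous at 0 and vanishes on an interval to
  the right of 0, so a one-sided limit gives \<open>d i = 0\<close>; nothing is assumed about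
  negative \<open>x\<close>.\<close>

lemma powser_eq_zero:
  fixes d :: "nat \<Rightarrow> real"
  assumes r: "r > 0" and d: "\<And>x. 0 < x \<Longrightarrow> x < r \<Longrightarrow> (\<lambda>i. d i * x ^ i) sums 0"
  shows "d i = 0"
proof (induction i rule: less_induct)
  case (less i)
  let ?e = "\<lambda>j. d (j + i)"
  define F where "F x = (\<Sum>j. ?e j * x ^ j)" for x
  have z: "(\<lambda>j. ?e j * x ^ j) sums 0" if x: "0 < x" "x < r" for x
  proof -
    have "(\<lambda>j. d (j + i) * x ^ (j + i)) sums (0 - (\<Sum>j<i. d j * x ^ j))"
      by (rule sums_split_initial_segment[OF d[OF x]])
    then have "(\<lambda>j. (d (j + i) * x ^ (j + i)) * (1 / x ^ i)) sums (0 * (1 / x ^ i))"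
      using less by (intro sums_mult2) auto
    then show ?thesis
      using x by (simp add: power_add field_simps)
  qed
  have F: "(\<lambda>j. ?e j * x ^ j) sums F x" if "norm x < r / 2" for x
  proof -
    have "summable (\<lambda>j. ?e j * x ^ j)"
      \<comment> \<open>Convergence at the single positive point \<open>r / 2\<close> gives
        convergence on the whole symmetric interval, as the two-sided limit theorem
        requires.\<close>
      using z[of "r / 2"] r that by (intro powser_inside[of ?e "r / 2" x]) (auto simp: sums_iff)
    then show ?thesis unfolding F_def by (rule summable_sums)
  qed
  have "(F \<longlongrightarrow> ?e 0) (at 0)"
    by (rule powser_limit_0[of "r / 2"]) (use F r in auto)
  then have "(F \<longlongrightarrow> ?e 0) (at_right 0)"
    by (rule filterlim_mono) (auto simp: at_le)
  moreover have "\<forall>\<^sub>F x in at_right 0. F x = 0"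
    using eventually_at_right_less[of 0] eventually_at_right_real[OF r]
    by eventually_elim (use z in \<open>auto simp: F_def sums_iff\<close>)
  then have "(F \<longlongrightarrow> 0) (at_right 0)"
    by (simp add: tendsto_eventually)
  ultimately show ?case
    using tendsto_unique[of "at_right (0::real)"] by force
qed

text \<open>This carries out every comparison of coefficients below: \<open>A n\<close> and
  \<open>B n\<close> are the generating functions of the rows, and an equality of their sums over
  \<open>n\<close> for all small \<open>x > 0\<close> descends to each column. The existential
  states convergence and equality together without naming the common value.\<close>

lemma sums_coeffs_eq:
  fixes a b :: "nat \<Rightarrow> nat \<Rightarrow> real"
  assumes r: "r > 0"
    and nonneg: "\<And>n i. 0 \<le> a n i" "\<And>n i. 0 \<le> b n i"
    and a: "\<And>x n. 0 < x \<Longrightarrow> x < r \<Longrightarrow> (\<lambda>i. a n i * x ^ i) sums A n x"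
    and b: "\<And>x n. 0 < x \<Longrightarrow> x < r \<Longrightarrow> (\<lambda>i. b n i * x ^ i) sums B n x"
    and AB: "\<And>x. 0 < x \<Longrightarrow> x < r \<Longrightarrow> \<exists>s. (\<lambda>n. A n x) sums s \<and> (\<lambda>n. B n x) sums s"
  shows "\<exists>s. (\<lambda>n. a n i) sums s \<and> (\<lambda>n. b n i) sums s"
proof -
  \<comment> \<open>Tonelli applies to the array \<open>c n i * x ^ i\<close>; the factor
    \<open>x ^ i\<close> is then divided out of each column.\<close>
  have cols: "summable (\<lambda>n. c n i)" "(\<lambda>i. (\<Sum>n. c n i) * x ^ i) sums s"
    if c: "\<And>n i. 0 \<le> c n i" "\<And>n. (\<lambda>i. c n i * x ^ i) sums C n" "C sums s" and x: "0 < x"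
    for c :: "nat \<Rightarrow> nat \<Rightarrow> real" and C s x i
  proof -
    have *: "summable (\<lambda>n. c n i * x ^ i)" "(\<lambda>i. \<Sum>n. c n i * x ^ i) sums s" for i
      using tonelli_sums[of "\<lambda>n i. c n i * x ^ i" C s] c x by auto
    have **: "summable (\<lambda>n. c n i)" for i
      using summable_mult2[OF *(1)[of i], of "1 / x ^ i"] x by simp
    then show "summable (\<lambda>n. c n i)" .
    show "(\<lambda>i. (\<Sum>n. c n i) * x ^ i) sums s"
      using *(2) by (simp add: suminf_mult2[OF **])
  qed
  have eq: "(\<lambda>i. ((\<Sum>n. a n i) - (\<Sum>n. b n i)) * x ^ i) sums 0" if x: "0 < x" "x < r" for x
  proof -
    obtain s where s: "(\<lambda>n. A n x) sums s" "(\<lambda>n. B n x) sums s" using AB[OF x] by blast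
    show ?thesis
      using sums_diff[OF cols(2)[OF nonneg(1) a[OF x] s(1) x(1)] cols(2)[OF nonneg(2) b[OF x] s(2) x(1)]]
      by (simp add: algebra_simps)
  qed
  have "(\<Sum>n. a n i) = (\<Sum>n. b n i)"
    using powser_eq_zero[OF r eq] by simp
  moreover obtain x where x: "0 < x" "x < r" using dense[OF r] by blast
  obtain s where s: "(\<lambda>n. A n x) sums s" "(\<lambda>n. B n x) sums s" using AB[OF x] by blast
  have "summable (\<lambda>n. a n i)" "summable (\<lambda>n. b n i)"
    using cols(1)[OF nonneg(1) a[OF x] s(1) x(1)] cols(1)[OF nonneg(2) b[OF x] s(2) x(1)] by auto
  ultimately show ?thesis
    by (metis summable_sums)
qed

subsection \<open>Multiple harmonic sums and their generating functions\<close>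

text \<open>A general weight \<open>w\<close> treats 1/j and 1/(2j-1) at once. These are the
  elementary symmetric polynomials in \<open>w 1\<close>, ..., \<open>w n\<close>; the weak sums are
  the complete homogeneous ones.\<close>

definition strict_sum :: "(nat \<Rightarrow> real) \<Rightarrow> nat \<Rightarrow> nat \<Rightarrow> real" where
  "strict_sum w n d = (\<Sum>ns\<in>strict_indices n d. \<Prod>j\<leftarrow>ns. w j)"

definition weak_sum :: "(nat \<Rightarrow> real) \<Rightarrow> nat \<Rightarrow> nat \<Rightarrow> real" where
  "weak_sum w n d = (\<Sum>ns\<in>weak_indices n d. \<Prod>j\<leftarrow>ns. w j)"

lemma trunc_conv_weighted_sum:
  "zeta_trunc = strict_sum (\<lambda>j. 1 / real j)" "t_trunc = strict_sum (\<lambda>j. 1 / (2 * real j - 1))"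
  "zeta_star_trunc = weak_sum (\<lambda>j. 1 / real j)" "t_star_trunc = weak_sum (\<lambda>j. 1 / (2 * real j - 1))"
  by (simp_all add: fun_eq_iff zeta_trunc_def t_trunc_def zeta_star_trunc_def t_star_trunc_def
      strict_sum_def weak_sum_def)

text \<open>In a decreasing list the value \<open>Suc n\<close> can occur only at the head.
  Strictness then bounds the tail by \<open>n\<close>, whereas a weakly decreasing tail may repeat
  \<open>Suc n\<close>.\<close>

lemma strict_indices_Suc:
  "strict_indices (Suc n) (Suc d) = strict_indices n (Suc d) \<union> (#) (Suc n) ` strict_indices n d"
proof (intro equalityI subsetI)
  fix ns assume ns: "ns \<in> strict_indices (Suc n) (Suc d)"
  then obtain a l where l: "ns = a # l" by (cases ns) (auto simp: strict_indices_def)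
  show "ns \<in> strict_indices n (Suc d) \<union> (#) (Suc n) ` strict_indices n d"
    using ns unfolding l by (cases "a = Suc n") (fastforce simp: strict_indices_def)+
qed (force simp: strict_indices_def)+

lemma weak_indices_Suc:
  "weak_indices (Suc n) (Suc d) = weak_indices n (Suc d) \<union> (#) (Suc n) ` weak_indices (Suc n) d"
proof (intro equalityI subsetI)
  fix ns assume ns: "ns \<in> weak_indices (Suc n) (Suc d)"
  then obtain a l where l: "ns = a # l" by (cases ns) (auto simp: weak_indices_def)
  show "ns \<in> weak_indices n (Suc d) \<union> (#) (Suc n) ` weak_indices (Suc n) d"
    using ns unfolding l by (cases "a = Suc n") (fastforce simp: weak_indices_def)+
qed (force simp: weak_indices_def)+

lemma strict_sum_simps [simp]:
  "strict_sum w n 0 = 1"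
  "strict_sum w 0 (Suc d) = 0"
  "strict_sum w (Suc n) (Suc d) = strict_sum w n (Suc d) + w (Suc n) * strict_sum w n d"
proof -
  show "strict_sum w n 0 = 1" by (simp add: strict_sum_def strict_indices_0)
  have "strict_indices 0 (Suc d) = {}" by (auto simp: strict_indices_def)
  then show "strict_sum w 0 (Suc d) = 0" by (simp add: strict_sum_def)
  have "strict_indices n (Suc d) \<inter> (#) (Suc n) ` strict_indices n d = {}"
    by (auto simp: strict_indices_def)
  then show "strict_sum w (Suc n) (Suc d) = strict_sum w n (Suc d) + w (Suc n) * strict_sum w n d"
    unfolding strict_sum_def strict_indices_Suc
    by (subst sum.union_disjoint)
      (auto simp: finite_strict_indices sum.reindex sum_distrib_left)
qed

lemma weak_sum_simps [simp]:
  "weak_sum w n 0 = 1"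
  "weak_sum w 0 (Suc d) = 0"
  "weak_sum w (Suc n) (Suc d) = weak_sum w n (Suc d) + w (Suc n) * weak_sum w (Suc n) d"
proof -
  show "weak_sum w n 0 = 1" by (simp add: weak_sum_def weak_indices_0)
  have "weak_indices 0 (Suc d) = {}" by (auto simp: weak_indices_def)
  then show "weak_sum w 0 (Suc d) = 0" by (simp add: weak_sum_def)
  have "weak_indices n (Suc d) \<inter> (#) (Suc n) ` weak_indices (Suc n) d = {}"
    by (auto simp: weak_indices_def)
  then show "weak_sum w (Suc n) (Suc d) = weak_sum w n (Suc d) + w (Suc n) * weak_sum w (Suc n) d"
    unfolding weak_sum_def weak_indices_Suc
    by (subst sum.union_disjoint)
      (auto simp: finite_weak_indices sum.reindex sum_distrib_left)
qed

lemma strict_sum_nonneg: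
  assumes "\<And>j. 0 < j \<Longrightarrow> 0 \<le> w j"
  shows "0 \<le> strict_sum w n d"
proof (induction n arbitrary: d)
  case 0 then show ?case by (cases d) auto
next
  case (Suc n) then show ?case using assms by (cases d) auto
qed

lemma weak_sum_nonneg:
  assumes "\<And>j. 0 < j \<Longrightarrow> 0 \<le> w j"
  shows "0 \<le> weak_sum w n d"
proof (induction n arbitrary: d)
  case 0 then show ?case by (cases d) auto
next
  case (Suc n)
  then show ?case using assms by (induction d) auto
qed

text \<open>Passing from \<open>n\<close> to \<open>Suc n\<close> multiplies the generating function
  by \<open>1 + w (Suc n) * x\<close>. The series has finitely many nonzero terms, so
  \<open>x\<close> is arbitrary.\<close>

lemma strict_sum_genfun: "(\<lambda>d. strict_sum w n d * x ^ d) sums (\<Prod>j=1..n. 1 + w j * x)"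
proof (induction n)
  case 0
  show ?case using sums_Suc_iff[of "\<lambda>d. strict_sum w 0 d * x ^ d" 0] by simp
next
  case (Suc n)
  let ?P = "\<Prod>j=1..n. 1 + w j * x"
  have "(\<lambda>d. strict_sum w n (Suc d) * x ^ Suc d) sums (?P - 1)"
    using Suc sums_Suc_iff[of "\<lambda>d. strict_sum w n d * x ^ d" "?P - 1"] by simp
  from sums_add[OF this sums_mult[OF Suc, of "w (Suc n) * x"]]
  have "(\<lambda>d. strict_sum w (Suc n) (Suc d) * x ^ Suc d) sums (?P - 1 + w (Suc n) * x * ?P)"
    by (simp add: algebra_simps)
  then show ?case
    using sums_Suc_iff[of "\<lambda>d. strict_sum w (Suc n) d * x ^ d" "?P - 1 + w (Suc n) * x * ?P"]
    by (simp add: algebra_simps)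
qed

text \<open>Passing from \<open>n\<close> to \<open>Suc n\<close> is a Cauchy product with the
  geometric series in \<open>w (Suc n) * x\<close>; the hypotheses make that series converge and all
  terms nonnegative.\<close>

lemma weak_sum_genfun:
  assumes w: "\<And>j. 0 < j \<Longrightarrow> 0 \<le> w j" "\<And>j. 0 < j \<Longrightarrow> w j * x < 1" and x: "0 \<le> x"
  shows "(\<lambda>d. weak_sum w n d * x ^ d) sums (\<Prod>j=1..n. 1 / (1 - w j * x))"
proof (induction n)
  case 0
  show ?case using sums_Suc_iff[of "\<lambda>d. weak_sum w 0 d * x ^ d" 0] by simp
next
  case (Suc n)
  let ?v = "w (Suc n)"
  have nonneg: "0 \<le> weak_sum w n i * x ^ i" for i
    using weak_sum_nonneg[OF w(1)] x by simp
  have v: "0 \<le> ?v * x" "?v * x < 1" using w x by auto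
  \<comment> \<open>Unrolling the recursion in \<open>d\<close>: the index \<open>d - i\<close>
    counts how often \<open>Suc n\<close> occurs in the list.\<close>
  have conv: "weak_sum w (Suc n) d * x ^ d = (\<Sum>i\<le>d. (weak_sum w n i * x ^ i) * (?v * x) ^ (d - i))"
    for d
  proof (induction d)
    case (Suc d)
    have "(\<Sum>i\<le>Suc d. (weak_sum w n i * x ^ i) * (?v * x) ^ (Suc d - i))
      = weak_sum w n (Suc d) * x ^ Suc d
        + (?v * x) * (\<Sum>i\<le>d. (weak_sum w n i * x ^ i) * (?v * x) ^ (d - i))"
      by (auto simp: sum_distrib_left Suc_diff_le mult_ac intro!: sum.cong)
    then show ?case unfolding Suc[symmetric] by (simp add: algebra_simps)
  qed simp
  have "(\<lambda>d. \<Sum>i\<le>d. (weak_sum w n i * x ^ i) * (?v * x) ^ (d - i)) sums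
      ((\<Sum>d. weak_sum w n d * x ^ d) * (\<Sum>d. (?v * x) ^ d))"
    by (rule Cauchy_product_sums)
      (use Suc nonneg v in \<open>auto simp: sums_iff power_mult_distrib[symmetric] intro: summable_geometric\<close>)
  also have "(\<Sum>d. weak_sum w n d * x ^ d) * (\<Sum>d. (?v * x) ^ d)
      = (\<Prod>j=1..Suc n. 1 / (1 - w j * x))"
    using Suc v by (simp add: sums_iff suminf_geometric)
  finally show ?case unfolding conv .
qed

subsection \<open>A digamma difference as a hypergeometric series\<close>

text \<open>By Euler's limit formula for Gamma the quotient is asymptotic to
  \<open>Gamma c / Gamma a * n powr (a - c)\<close>, and the exponent is negative.\<close>

lemma pochhammer_quotient_tendsto_0:
  fixes a c :: real
  assumes "0 < a" "a < c"
  shows "(\<lambda>n. pochhammer a (Suc n) / pochhammer c (Suc n)) \<longlonglongrightarrow> 0"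
proof -
  have pos: "0 < pochhammer a n" "0 < pochhammer c n" for n
    using assms by (auto intro: pochhammer_pos)
  have "(\<lambda>n. Gamma_series c n / Gamma_series a n * real n powr (a - c)) \<longlonglongrightarrow> Gamma c / Gamma a * 0"
    using assms
    by (intro tendsto_intros Gamma_series_LIMSEQ tendsto_neg_powr filterlim_real_sequentially)
      (auto simp: Gamma_eq_zero_iff dest: nonpos_Ints_nonpos)
  moreover have "\<forall>\<^sub>F n in sequentially. Gamma_series c n / Gamma_series a n * real n powr (a - c)
      = pochhammer a (Suc n) / pochhammer c (Suc n)"
    using eventually_gt_at_top[of 0]
  proof eventually_elim
    case (elim n)
    then have e: "exp (z * ln (real n)) = real n powr z" for z by (simp add: powr_def)
    have "real n powr c * real n powr (a - c) = real n powr a"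
      by (simp add: powr_add[symmetric])
    moreover have "0 < real n powr a" using elim by simp
    ultimately show ?case
      using pos[of "Suc n"] by (simp add: Gamma_series_def e field_simps)
  qed
  ultimately show ?thesis
    by (simp add: tendsto_cong)
qed

text \<open>The quotients \<open>T n\<close> of equal length telescope: consecutive differences are
  \<open>c - a\<close> times the summand, the first value is \<open>a / c\<close>, and the limit is
  0.\<close>

lemma pochhammer_over_sums:
  fixes a c :: real
  assumes "0 < a" "a < c"
  shows "(\<lambda>n. pochhammer a (Suc n) / pochhammer c (Suc (Suc n))) sums (1 / (c - a) - 1 / c)"
proof -
  define T where "T n = pochhammer a (Suc n) / pochhammer c (Suc n)" for n
  have pos: "0 < pochhammer c n" for n
    using assms by (auto intro: pochhammer_pos)
  have T: "T n - T (Suc n) = (c - a) * (pochhammer a (Suc n) / pochhammer c (Suc (Suc n)))" for n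
  proof -
    have "c + real (Suc n) > 0" using assms by simp
    with pos[of "Suc n"] show ?thesis
      unfolding T_def pochhammer_rec'[of a "Suc n"] pochhammer_rec'[of c "Suc n"]
      by (simp add: divide_simps del: of_nat_Suc) (simp add: algebra_simps)
  qed
  have "(\<lambda>n. T n - T (Suc n)) sums (T 0 - 0)"
    by (rule telescope_sums') (use pochhammer_quotient_tendsto_0[OF assms] in \<open>simp add: T_def\<close>)
  then have "(\<lambda>n. (1 / (c - a)) * (T n - T (Suc n))) sums ((1 / (c - a)) * (T 0 - 0))"
    by (rule sums_mult)
  moreover have "(1 / (c - a)) * (T 0 - 0) = 1 / (c - a) - 1 / c"
    using assms by (simp add: T_def field_simps)
  ultimately show ?thesis using assms by (simp add: T)
qed

text \<open>This telescopes in the shift \<open>N\<close>: the products at \<open>c + N\<close> and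
  \<open>c + N + 1\<close> share all but their outermost factors, which differ by
  \<open>Suc n\<close>.\<close>

lemma pochhammer_shift_sums:
  fixes c :: real
  assumes "0 < c"
  shows "(\<lambda>N. 1 / pochhammer (c + real N) (Suc (Suc n))) sums (1 / (real (Suc n) * pochhammer c (Suc n)))"
proof -
  define T where "T N = 1 / (real (Suc n) * pochhammer (c + real N) (Suc n))" for N
  have pos: "0 < pochhammer (c + real N) k" for N k
    using assms by (auto intro: pochhammer_pos)
  have T: "T N - T (Suc N) = 1 / pochhammer (c + real N) (Suc (Suc n))" for N
  proof -
    let ?z = "c + real N"
    have z: "?z > 0" "?z + real (Suc n) > 0" using assms by simp_all
    have p: "0 < pochhammer (?z + 1) n"
      using assms by (auto intro: pochhammer_pos)
    have 1: "pochhammer ?z (Suc n) = ?z * pochhammer (?z + 1) n"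
      "pochhammer (?z + 1) (Suc n) = (?z + real (Suc n)) * pochhammer (?z + 1) n"
      "pochhammer ?z (Suc (Suc n)) = ?z * ((?z + real (Suc n)) * pochhammer (?z + 1) n)"
      using pochhammer_rec'[of "?z + 1" n] by (simp_all add: pochhammer_rec[of ?z] add_ac)
    have 2: "c + real (Suc N) = ?z + 1" by simp
    show ?thesis
      unfolding T_def 1 2 using z p
      by (simp add: divide_simps del: of_nat_Suc)
  qed
  have "T \<longlonglongrightarrow> 0"
  proof (rule tendsto_sandwich[OF _ _ tendsto_const])
    show "\<forall>\<^sub>F N in sequentially. 0 \<le> T N"
      using pos by (auto simp: T_def less_imp_le)
    \<comment> \<open>A crude bound suffices: keep the first factor \<open>c + real N\<close> and
      bound the other \<open>n\<close> factors below by their values at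
      \<open>N = 0\<close>.\<close>
    have "T N \<le> 1 / pochhammer c n * inverse (c + real N)" for N
    proof -
      have "pochhammer c n \<le> pochhammer (c + real N) n"
        unfolding pochhammer_prod using assms by (intro prod_mono) auto
      also have "\<dots> \<le> pochhammer (c + real N + 1) n"
        unfolding pochhammer_prod using assms by (intro prod_mono) auto
      finally have "(c + real N) * pochhammer c n \<le> pochhammer (c + real N) (Suc n)"
        unfolding pochhammer_rec[of "c + real N"] using assms by (intro mult_left_mono) auto
      also have "\<dots> \<le> real (Suc n) * pochhammer (c + real N) (Suc n)"
        using mult_right_mono[of 1 "real (Suc n)" "pochhammer (c + real N) (Suc n)"] pos[of N "Suc n"]
        by (simp del: of_nat_Suc)
      finally have *: "(c + real N) * pochhammer c n \<le> real (Suc n) * pochhammer (c + real N) (Suc n)" .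
      have "0 < (c + real N) * pochhammer c n"
        using assms by (auto intro!: mult_pos_pos pochhammer_pos)
      from frac_le[OF zero_le_one order_refl this *] show ?thesis
        by (simp add: T_def divide_inverse mult.commute del: of_nat_Suc)
    qed
    then show "\<forall>\<^sub>F N in sequentially. T N \<le> 1 / pochhammer c n * inverse (c + real N)" by simp
    have "filterlim (\<lambda>N. c + real N) at_top sequentially"
      by (rule filterlim_tendsto_add_at_top[OF tendsto_const filterlim_real_sequentially])
    then have "(\<lambda>N. inverse (c + real N)) \<longlonglongrightarrow> 0"
      by (rule tendsto_inverse_0_at_top)
    then show "(\<lambda>N. 1 / pochhammer c n * inverse (c + real N)) \<longlonglongrightarrow> 0"
      using tendsto_mult_right_zero by blast
  qed
  then have "(\<lambda>N. T N - T (Suc N)) sums (T 0 - 0)"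
    by (rule telescope_sums')
  then show ?thesis by (simp add: T) (simp add: T_def)
qed

text \<open>The sum is digamma(c) - digamma(c - a). Each term equals
  \<open>a / ((c + N - a) * (c + N))\<close>, which is of order 1/N^2.\<close>

lemma digamma_diff_summable:
  fixes a c :: real
  assumes "0 < a" "a < c"
  shows "summable (\<lambda>N. 1 / (c + real N - a) - 1 / (c + real N))"
proof (rule summable_comparison_test)
  have "summable (\<lambda>N. inverse (real (Suc N) ^ 2))"
    using inverse_power_summable[of 2, where 'a = real] by (subst summable_Suc_iff) simp
  then show "summable (\<lambda>N. a / (min 1 (c - a))\<^sup>2 * inverse (real (Suc N) ^ 2))"
    by (rule summable_mult)
  have "norm (1 / (c + real N - a) - 1 / (c + real N)) \<le> a / (min 1 (c - a))\<^sup>2 * inverse (real (Suc N) ^ 2)"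
    for N
  proof -
    \<comment> \<open>With \<open>e \<le> 1\<close> for the part \<open>N\<close> and
      \<open>e \<le> c - a\<close> for the constant part, \<open>e * Suc N\<close> stays below
      \<open>c + N - a\<close>, also at \<open>N = 0\<close>.\<close>
    define e where "e = min 1 (c - a)"
    have e: "0 < e" "e \<le> 1" "e \<le> c - a" using assms by (auto simp: e_def)
    have le: "e * real (Suc N) \<le> c + real N - a"
      using e mult_right_mono[of e 1 "real N"] by (simp add: algebra_simps)
    have p: "0 < e * real (Suc N)" using e by simp
    have "(e * real (Suc N))\<^sup>2 \<le> (c + real N - a) * (c + real N)"
      unfolding power2_eq_square using le p assms by (intro mult_mono) auto
    from frac_le[OF _ order_refl zero_less_power[OF p] this, of a] assms
    have "a / ((c + real N - a) * (c + real N)) \<le> a / (e * real (Suc N))\<^sup>2"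
      by (simp del: of_nat_Suc)
    moreover have "1 / (c + real N - a) - 1 / (c + real N) = a / ((c + real N - a) * (c + real N))"
      using assms by (simp add: field_simps)
    moreover have "0 \<le> a / ((c + real N - a) * (c + real N))" using assms by simp
    ultimately show ?thesis
      unfolding e_def[symmetric] by (simp add: power_mult_distrib divide_inverse)
  qed
  then show "\<exists>N0. \<forall>N\<ge>N0. norm (1 / (c + real N - a) - 1 / (c + real N))
      \<le> a / (min 1 (c - a))\<^sup>2 * inverse (real (Suc N) ^ 2)" by blast
qed

lemma pochhammer_digamma_sums:
  fixes a c :: real
  assumes "0 < a" "a < c"
  shows "\<exists>s. (\<lambda>n. pochhammer a (Suc n) / (real (Suc n) * pochhammer c (Suc n))) sums s
    \<and> (\<lambda>N. 1 / (c + real N - a) - 1 / (c + real N)) sums s"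
proof -
  let ?R = "\<lambda>N. 1 / (c + real N - a) - 1 / (c + real N)"
  \<comment> \<open>Both sides are iterated sums of this nonnegative array, and both inner sums telescope.\<close>
  define f where "f N n = pochhammer a (Suc n) / pochhammer (c + real N) (Suc (Suc n))" for N n
  have "0 \<le> f N n" for N n
    unfolding f_def using assms
    by (intro divide_nonneg_nonneg less_imp_le[OF pochhammer_pos]) auto
  moreover have "f N sums ?R N" for N
    unfolding f_def using pochhammer_over_sums[of a "c + real N"] assms by simp
  moreover obtain s where s: "?R sums s"
    using digamma_diff_summable[OF assms] by (auto simp: summable_def)
  ultimately have "(\<lambda>n. \<Sum>N. f N n) sums s"
    by (rule tonelli_sums)
  moreover have "(\<Sum>N. f N n) = pochhammer a (Suc n) / (real (Suc n) * pochhammer c (Suc n))" for n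
  proof (rule sums_unique[symmetric])
    show "(\<lambda>N. f N n) sums (pochhammer a (Suc n) / (real (Suc n) * pochhammer c (Suc n)))"
      unfolding f_def
      using sums_mult[OF pochhammer_shift_sums[of c n], of "pochhammer a (Suc n)"] assms by simp
  qed
  ultimately show ?thesis using s by auto
qed

section \<open>Negative binomial expansion, Pochhammer symbols as products, and sums over odd
  integers\<close>

lemma negative_binomial_sums:
  fixes d u :: real
  assumes "0 < d" "\<bar>u\<bar> < d"
  shows "(\<lambda>j. real ((m + j) choose j) / d ^ (m + j + 1) * u ^ j) sums (1 / (d - u) ^ (m + 1))"
proof -
  have lt: "\<bar>- u / d\<bar> < 1" using assms by simp
  have pos: "0 < 1 - u / d" using assms by (simp add: field_simps)
  \<comment> \<open>Negating the upper index produces a sign that cancels against the one in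
    \<open>(- u / d) ^ j\<close>.\<close>
  have "(- real (m + 1) gchoose j) = (-1) ^ j * real ((m + j) choose j)" for j
    by (subst gbinomial_minus) (simp add: binomial_gbinomial add_ac)
  with gen_binomial_real[OF lt, of "- real (m + 1)"]
  have "(\<lambda>j. (-1) ^ j * real ((m + j) choose j) * (- u / d) ^ j) sums (1 - u / d) powr (- real (m + 1))"
    by simp
  from sums_mult[OF this, of "1 / d ^ (m + 1)"]
  have *: "(\<lambda>j. 1 / d ^ (m + 1) * ((-1) ^ j * real ((m + j) choose j) * (- u / d) ^ j)) sums
      (1 / d ^ (m + 1) * (1 - u / d) powr (- real (m + 1)))" .
  have "1 / d ^ (m + 1) * ((-1) ^ j * real ((m + j) choose j) * (- u / d) ^ j)
      = real ((m + j) choose j) / d ^ (m + j + 1) * u ^ j" for j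
  proof -
    have "(-1) ^ j * (- u / d) ^ j = (u / d) ^ j"
      by (simp add: power_mult_distrib[symmetric])
    then have "(-1) ^ j * b * (- u / d) ^ j = b * (u / d) ^ j" for b
      by (metis mult.assoc mult.commute)
    then show ?thesis by (simp add: power_divide power_add)
  qed
  moreover have "1 / d ^ (m + 1) * (1 - u / d) powr (- real (m + 1)) = 1 / (d - u) ^ (m + 1)"
  proof -
    have "(1 - u / d) powr (- real (m + 1)) = 1 / (1 - u / d) ^ (m + 1)"
      unfolding powr_minus_divide powr_realpow[OF pos] ..
    moreover have "d ^ (m + 1) * (1 - u / d) ^ (m + 1) = (d - u) ^ (m + 1)"
    proof -
      have "d * (1 - u / d) = d - u" using assms by (simp add: field_simps)
      then show ?thesis by (metis power_mult_distrib)
    qed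
    ultimately show ?thesis
      by (simp only: times_divide_times_eq mult_1)
  qed
  ultimately show ?thesis using * by simp
qed

text \<open>These three product formulas connect Pochhammer symbols with the generating functions:
  the first contains that of \<open>zeta_trunc\<close>, the reciprocal of the second that of
  \<open>zeta_star_trunc\<close>, and the third that of \<open>t_trunc\<close>, or of
  \<open>t_star_trunc\<close> after inversion and \<open>y\<close> replaced by
  \<open>- y\<close>.\<close>

lemma pochhammer_Suc_conv_prod:
  fixes x :: real
  shows "pochhammer x (Suc n) = x * fact n * (\<Prod>j=1..n. 1 + 1 / real j * x)"
  by (induction n) (simp_all add: pochhammer_rec'[of x] field_simps)

lemma pochhammer_one_minus_conv_prod:
  fixes x :: real
  shows "pochhammer (1 - x) n = fact n * (\<Prod>j=1..n. 1 - 1 / real j * x)"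
  by (induction n) (simp_all add: pochhammer_rec' field_simps)

lemma pochhammer_half_conv_prod:
  fixes y :: real
  shows "pochhammer ((1 + y) / 2) n = pochhammer (1 / 2) n * (\<Prod>j=1..n. 1 + 1 / (2 * real j - 1) * y)"
proof (induction n)
  case (Suc n)
  have "(1 + y) / 2 + real n = (1 / 2 + real n) * (1 + 1 / (2 * real (Suc n) - 1) * y)"
    by (simp add: field_simps)
  with Suc show ?case by (simp add: pochhammer_rec' del: of_nat_Suc)
qed simp

lemma central_binomial_pochhammer:
  "real ((2 * n) choose n) = 4 ^ n * pochhammer (1 / 2) n / fact n"
proof -
  have "real ((2 * n) choose n) = fact (2 * n) / (fact n * fact n)"
    by (subst binomial_fact) simp_all
  then show ?thesis by (simp add: fact_double power_mult)
qed

text \<open>Group the zeta series into pairs of an odd and an even term; the even terms add up to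
  \<open>1 / 2 ^ s * zeta s\<close> and are subtracted.\<close>

lemma odd_zeta_sums:
  assumes "s \<ge> 2"
  shows "(\<lambda>N. 1 / (2 * real N + 1) ^ s) sums ((1 - 1 / 2 ^ s) * zeta s)"
proof -
  have "(\<lambda>N. sum (\<lambda>n. 1 / real (Suc n) ^ s) {N * 2..<N * 2 + 2}) sums zeta s"
    by (rule sums_group[OF zeta_sums[OF assms]]) simp
  moreover have "(\<lambda>N. 1 / 2 ^ s * (1 / real (Suc N) ^ s)) sums (1 / 2 ^ s * zeta s)"
    by (rule sums_mult[OF zeta_sums[OF assms]])
  ultimately have "(\<lambda>N. sum (\<lambda>n. 1 / real (Suc n) ^ s) {N * 2..<N * 2 + 2}
      - 1 / 2 ^ s * (1 / real (Suc N) ^ s)) sums (zeta s - 1 / 2 ^ s * zeta s)"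
    by (rule sums_diff)
  moreover have "sum (\<lambda>n. 1 / real (Suc n) ^ s) {N * 2..<N * 2 + 2}
      - 1 / 2 ^ s * (1 / real (Suc N) ^ s) = 1 / (2 * real N + 1) ^ s" for N
  proof -
    have "{N * 2..<N * 2 + 2} = {2 * N, Suc (2 * N)}" by auto
    moreover have "real (Suc (Suc (2 * N))) ^ s = 2 ^ s * real (Suc N) ^ s"
      unfolding power_mult_distrib[symmetric] by simp
    ultimately show ?thesis by (simp add: add.commute del: of_nat_Suc) simp
  qed
  ultimately show ?thesis by (simp add: algebra_simps)
qed

subsection \<open>Comparison of coefficients\<close>

lemma prod_one_over_one_minus: "(\<Prod>j=1..n. 1 / (1 - w j * x)) = 1 / (\<Prod>j=1..n. 1 - w j * (x::real))"
  by (simp add: prod_dividef)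

lemma zeta_trunc_nonneg: "0 \<le> zeta_trunc n d"
  unfolding trunc_conv_weighted_sum by (rule strict_sum_nonneg) simp

lemma t_trunc_nonneg: "0 \<le> t_trunc n d"
  unfolding trunc_conv_weighted_sum by (rule strict_sum_nonneg) simp

lemma zeta_star_trunc_nonneg: "0 \<le> zeta_star_trunc n d"
  unfolding trunc_conv_weighted_sum by (rule weak_sum_nonneg) simp

lemma t_star_trunc_nonneg: "0 \<le> t_star_trunc n d"
  unfolding trunc_conv_weighted_sum by (rule weak_sum_nonneg) simp

text \<open>This is the coefficient of \<open>x ^ m\<close> in
  \<open>pochhammer_digamma_sums\<close> with \<open>a = x\<close>, where \<open>c\<close> stays
  free for the second comparison.\<close>

lemma zeta_trunc_pochhammer_sums:
  fixes c :: real
  assumes m: "m \<ge> 1" and c: "0 < c"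
  shows "\<exists>s. (\<lambda>n. zeta_trunc n (m - 1) * fact n / (real (Suc n) * pochhammer c (Suc n))) sums s
    \<and> (\<lambda>N. 1 / (c + real N) ^ (m + 1)) sums s"
proof -
  \<comment> \<open>The leading factor \<open>x\<close> of \<open>pochhammer x (Suc n)\<close>
    shifts the depth by one, hence \<open>i - 1\<close> and a zero constant term. In
    \<open>b\<close> the constant term cancels against \<open>1 / (c + real N)\<close>.\<close>
  define a where "a n i = (if i = 0 then 0 else zeta_trunc n (i - 1)) * fact n / (real (Suc n) * pochhammer c (Suc n))"
    for n i
  define b where "b N i = (if i = 0 then 0 else 1 / (c + real N) ^ (i + 1))" for N i
  have pc: "0 < pochhammer c n" for n
    using c by (rule pochhammer_pos)
  have "\<exists>s. (\<lambda>n. a n m) sums s \<and> (\<lambda>N. b N m) sums s"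
  proof (rule sums_coeffs_eq[OF c])
    show "0 \<le> a n i" for n i
      unfolding a_def using zeta_trunc_nonneg pc[of "Suc n"] by (auto simp del: of_nat_Suc)
    show "0 \<le> b N i" for N i
      unfolding b_def using c by auto
    fix x assume x: "0 < x" "x < c"
    show "(\<lambda>i. a n i * x ^ i) sums (pochhammer x (Suc n) / (real (Suc n) * pochhammer c (Suc n)))" for n
    proof (rule sums_Suc_imp)
      have "(\<lambda>i. x * fact n / (real (Suc n) * pochhammer c (Suc n)) * (zeta_trunc n i * x ^ i))
        sums (x * fact n / (real (Suc n) * pochhammer c (Suc n)) * (\<Prod>j=1..n. 1 + 1 / real j * x))"
        unfolding trunc_conv_weighted_sum by (intro sums_mult strict_sum_genfun)
      then show "(\<lambda>i. a n (Suc i) * x ^ Suc i)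
          sums (pochhammer x (Suc n) / (real (Suc n) * pochhammer c (Suc n)))"
        unfolding pochhammer_Suc_conv_prod[of x] a_def by (simp add: mult_ac del: of_nat_Suc)
    qed (simp add: a_def)
    show "(\<lambda>i. b N i * x ^ i) sums (1 / (c + real N - x) - 1 / (c + real N))" for N
    proof (rule sums_Suc_imp)
      have "(\<lambda>i. 1 / (c + real N) ^ (i + 1) * x ^ i) sums (1 / (c + real N - x))"
        using negative_binomial_sums[of "c + real N" x 0] x c by simp
      then show "(\<lambda>i. b N (Suc i) * x ^ Suc i) sums (1 / (c + real N - x) - 1 / (c + real N))"
        using sums_Suc_iff[of "\<lambda>i. 1 / (c + real N) ^ (i + 1) * x ^ i" "1 / (c + real N - x) - 1 / (c + real N)"]
        by (simp add: b_def)
    qed (simp add: b_def)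
    show "\<exists>s. (\<lambda>n. pochhammer x (Suc n) / (real (Suc n) * pochhammer c (Suc n))) sums s
        \<and> (\<lambda>N. 1 / (c + real N - x) - 1 / (c + real N)) sums s"
      by (rule pochhammer_digamma_sums[OF x])
  qed
  with m show ?thesis
    by (simp add: a_def b_def)
qed

text \<open>Now \<open>c = (1 - y) / 2\<close> and the coefficient of \<open>y ^ k\<close> is taken.
  The power \<open>2 ^ (m + 1)\<close> comes from
  \<open>c + N = (2 * N + 1 - y) / 2\<close>.\<close>

lemma zeta_t_star_sums:
  assumes m: "m \<ge> 1"
  shows "\<exists>s. (\<lambda>n. zeta_trunc n (m - 1) * fact n / (real (Suc n) * pochhammer (1 / 2) (Suc n))
        * t_star_trunc (Suc n) k) sums s
    \<and> (\<lambda>N. 2 ^ (m + 1) * (real ((m + k) choose k) / (2 * real N + 1) ^ (m + k + 1))) sums s"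
proof -
  define a where "a n i = zeta_trunc n (m - 1) * fact n / (real (Suc n) * pochhammer (1 / 2) (Suc n))
    * t_star_trunc (Suc n) i" for n i
  define b where "b N i = 2 ^ (m + 1) * (real ((m + i) choose i) / (2 * real N + 1) ^ (m + i + 1))"
    for N i
  have ph: "0 < pochhammer (1 / 2 :: real) n" for n
    by (rule pochhammer_pos) simp
  have "\<exists>s. (\<lambda>n. a n k) sums s \<and> (\<lambda>N. b N k) sums s"
  proof (rule sums_coeffs_eq[where r = 1])
    show "0 \<le> a n i" for n i
      unfolding a_def using ph[of "Suc n"]
      by (intro mult_nonneg_nonneg divide_nonneg_nonneg zeta_trunc_nonneg t_star_trunc_nonneg) auto
    show "0 \<le> b N i" for N i
      by (simp add: b_def)
    fix y :: real assume y: "0 < y" "y < 1"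
    have w: "1 / (2 * real j - 1) * y < 1" if "0 < j" for j
    proof -
      have "1 \<le> real j" using that by simp
      then show ?thesis using y by (simp add: field_simps)
    qed
    show "(\<lambda>i. a n i * y ^ i)
        sums (zeta_trunc n (m - 1) * fact n / (real (Suc n) * pochhammer ((1 - y) / 2) (Suc n)))" for n
    proof -
      have "pochhammer ((1 - y) / 2) (Suc n)
          = pochhammer (1 / 2) (Suc n) * (\<Prod>j=1..Suc n. 1 - 1 / (2 * real j - 1) * y)"
        using pochhammer_half_conv_prod[of "- y" "Suc n"] by (simp del: prod.cl_ivl_Suc)
      with sums_mult[OF weak_sum_genfun[of "\<lambda>j. 1 / (2 * real j - 1)" y "Suc n", OF _ w],
          of "zeta_trunc n (m - 1) * fact n / (real (Suc n) * pochhammer (1 / 2) (Suc n))"] y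
      show ?thesis
        unfolding a_def trunc_conv_weighted_sum prod_one_over_one_minus
        by (simp add: mult.assoc del: prod.cl_ivl_Suc of_nat_Suc)
    qed
    show "(\<lambda>i. b N i * y ^ i) sums (1 / ((1 - y) / 2 + real N) ^ (m + 1))" for N
    proof -
      have "(1 - y) / 2 + real N = (2 * real N + 1 - y) / 2" by (simp add: field_simps)
      then have "1 / ((1 - y) / 2 + real N) ^ (m + 1) = 2 ^ (m + 1) * (1 / (2 * real N + 1 - y) ^ (m + 1))"
        by (simp only: power_divide) simp
      with sums_mult[OF negative_binomial_sums[of "2 * real N + 1" y m], of "2 ^ (m + 1)"] y
      show ?thesis by (simp add: b_def mult.assoc)
    qed
    show "\<exists>s. (\<lambda>n. zeta_trunc n (m - 1) * fact n / (real (Suc n) * pochhammer ((1 - y) / 2) (Suc n))) sums s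
        \<and> (\<lambda>N. 1 / ((1 - y) / 2 + real N) ^ (m + 1)) sums s"
      using y by (intro zeta_trunc_pochhammer_sums[OF m]) simp
  qed simp
  then show ?thesis
    by (simp only: a_def b_def)
qed

text \<open>For fixed \<open>x\<close>, this is the coefficient of \<open>y ^ k\<close> in
  \<open>pochhammer_digamma_sums\<close> with \<open>a = (1 + y) / 2\<close> and
  \<open>c = 1 - x\<close>.\<close>

lemma t_trunc_pochhammer_sums:
  fixes x :: real
  assumes k: "k \<ge> 1" and x: "0 < x" "x < 1 / 2"
  shows "\<exists>s. (\<lambda>n. t_trunc (Suc n) k * pochhammer (1 / 2) (Suc n) / (real (Suc n) * pochhammer (1 - x) (Suc n))) sums s
    \<and> (\<lambda>N. 2 / (2 * real N + 1 - 2 * x) ^ (k + 1)) sums s"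
proof -
  define c where "c = 1 - x"
  define e where "e N = 2 * real N + 1 - 2 * x" for N
  define a where "a n i = t_trunc (Suc n) i * pochhammer (1 / 2) (Suc n) / (real (Suc n) * pochhammer c (Suc n))"
    for n i
  \<comment> \<open>The term \<open>1 / (c + real N)\<close> is free of \<open>y\<close> and affects
    only \<open>i = 0\<close>, so it is absent for \<open>k \<ge> 1\<close>. That coefficient is
    still nonnegative because \<open>e N / 2 = c + N - 1 / 2\<close>.\<close>
  define b where "b N i = 2 / e N ^ (i + 1) - (if i = 0 then 1 / (c + real N) else 0)" for N i
  have c: "0 < c" using x by (simp add: c_def)
  then have pc: "0 < pochhammer c n" for n by (rule pochhammer_pos)
  have ph: "0 < pochhammer (1 / 2 :: real) n" for n
    by (rule pochhammer_pos) simp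
  have e: "0 < e N" "e N / 2 \<le> c + real N" for N
    using x by (auto simp: e_def c_def field_simps)
  have "\<exists>s. (\<lambda>n. a n k) sums s \<and> (\<lambda>N. b N k) sums s"
  \<comment> \<open>The condition \<open>a < c\<close> reads \<open>y < 1 - 2 * x\<close>, which
    fixes the radius.\<close>
  proof (rule sums_coeffs_eq[where r = "1 - 2 * x"])
    show "0 < 1 - 2 * x" using x by simp
    show "0 \<le> a n i" for n i
      unfolding a_def using t_trunc_nonneg[of "Suc n" i] pc[of "Suc n"] ph[of "Suc n"]
      by (auto simp del: of_nat_Suc)
    show "0 \<le> b N i" for N i
      unfolding b_def using e[of N] frac_le[of 1 1 "e N / 2" "c + real N"] by auto
    fix y assume y: "0 < y" "y < 1 - 2 * x"
    show "(\<lambda>i. a n i * y ^ i)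
        sums (pochhammer ((1 + y) / 2) (Suc n) / (real (Suc n) * pochhammer c (Suc n)))" for n
      using sums_mult[OF strict_sum_genfun[of "\<lambda>j. 1 / (2 * real j - 1)" "Suc n" y],
        of "pochhammer (1 / 2) (Suc n) / (real (Suc n) * pochhammer c (Suc n))"]
      unfolding a_def trunc_conv_weighted_sum pochhammer_half_conv_prod
      by (simp add: mult_ac del: prod.cl_ivl_Suc of_nat_Suc)
    show "(\<lambda>i. b N i * y ^ i) sums (1 / (c + real N - (1 + y) / 2) - 1 / (c + real N))" for N
    proof -
      have "(\<lambda>i. 2 * (1 / e N ^ (i + 1) * y ^ i)) sums (2 * (1 / (e N - y)))"
      proof (rule sums_mult)
        have "\<bar>y\<bar> < e N" using y by (simp add: e_def)
        then show "(\<lambda>i. 1 / e N ^ (i + 1) * y ^ i) sums (1 / (e N - y))"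
          using negative_binomial_sums[of "e N" y 0] e[of N] by simp
      qed
      moreover have "2 * (1 / (e N - y)) = 1 / (c + real N - (1 + y) / 2)"
      proof -
        have "c + real N - (1 + y) / 2 = (e N - y) / 2" by (simp add: c_def e_def field_simps)
        then show ?thesis by (simp only:) simp
      qed
      moreover have "(\<lambda>i. if i = 0 then 1 / (c + real N) else 0) sums (1 / (c + real N))"
        using sums_single[of 0 "\<lambda>_. 1 / (c + real N)"] by simp
      ultimately have "(\<lambda>i. 2 * (1 / e N ^ (i + 1) * y ^ i) - (if i = 0 then 1 / (c + real N) else 0))
          sums (1 / (c + real N - (1 + y) / 2) - 1 / (c + real N))"
        using sums_diff by fastforce
      moreover have "b N i * y ^ i = 2 * (1 / e N ^ (i + 1) * y ^ i) - (if i = 0 then 1 / (c + real N) else 0)"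
        for i by (simp add: b_def left_diff_distrib)
      ultimately show ?thesis by simp
    qed
    show "\<exists>s. (\<lambda>n. pochhammer ((1 + y) / 2) (Suc n) / (real (Suc n) * pochhammer c (Suc n))) sums s
        \<and> (\<lambda>N. 1 / (c + real N - (1 + y) / 2) - 1 / (c + real N)) sums s"
      using y by (intro pochhammer_digamma_sums) (auto simp: c_def)
  qed
  with k show ?thesis
    by (simp add: a_def b_def c_def e_def)
qed

text \<open>Taking the coefficient of \<open>x ^ m\<close> leads to the same series over
  \<open>N\<close> as in \<open>zeta_t_star_sums\<close>, which is why the two sums agree. Here
  \<open>m = 0\<close> is allowed.\<close>

lemma t_zeta_star_sums:
  assumes k: "k \<ge> 1"
  shows "\<exists>s. (\<lambda>n. t_trunc (Suc n) k * pochhammer (1 / 2) (Suc n) / (real (Suc n) * fact (Suc n))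
        * zeta_star_trunc (Suc n) m) sums s
    \<and> (\<lambda>N. 2 ^ (m + 1) * (real ((m + k) choose k) / (2 * real N + 1) ^ (m + k + 1))) sums s"
proof -
  define a where "a n i = t_trunc (Suc n) k * pochhammer (1 / 2) (Suc n) / (real (Suc n) * fact (Suc n))
    * zeta_star_trunc (Suc n) i" for n i
  define b where "b N i = 2 ^ (i + 1) * (real ((i + k) choose k) / (2 * real N + 1) ^ (i + k + 1))"
    for N i
  have ph: "0 < pochhammer (1 / 2 :: real) n" for n
    by (rule pochhammer_pos) simp
  have "\<exists>s. (\<lambda>n. a n m) sums s \<and> (\<lambda>N. b N m) sums s"
  proof (rule sums_coeffs_eq[where r = "1 / 2"])
    show "0 \<le> a n i" for n i
      unfolding a_def using ph[of "Suc n"]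
      by (intro mult_nonneg_nonneg divide_nonneg_nonneg t_trunc_nonneg zeta_star_trunc_nonneg) auto
    show "0 \<le> b N i" for N i
      by (simp add: b_def)
    fix x :: real assume x: "0 < x" "x < 1 / 2"
    have w: "1 / real j * x < 1" if "0 < j" for j
    proof -
      have "1 \<le> real j" using that by simp
      then show ?thesis using x by (simp add: field_simps)
    qed
    show "(\<lambda>i. a n i * x ^ i)
        sums (t_trunc (Suc n) k * pochhammer (1 / 2) (Suc n) / (real (Suc n) * pochhammer (1 - x) (Suc n)))" for n
      using sums_mult[OF weak_sum_genfun[of "\<lambda>j. 1 / real j" x "Suc n", OF _ w],
          of "t_trunc (Suc n) k * pochhammer (1 / 2) (Suc n) / (real (Suc n) * fact (Suc n))"] x
      unfolding a_def trunc_conv_weighted_sum prod_one_over_one_minus pochhammer_one_minus_conv_prod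
      by (simp add: mult.assoc del: prod.cl_ivl_Suc of_nat_Suc fact_Suc)
    show "(\<lambda>i. b N i * x ^ i) sums (2 / (2 * real N + 1 - 2 * x) ^ (k + 1))" for N
    proof -
      \<comment> \<open>The negative binomial series is taken at \<open>u = 2 * x\<close>, so that
        \<open>2 * (2 * x) ^ i\<close> supplies the factor \<open>2 ^ (i + 1)\<close> of
        \<open>b\<close>.\<close>
      have "(\<lambda>i. 2 * (real ((k + i) choose i) / (2 * real N + 1) ^ (k + i + 1) * (2 * x) ^ i))
          sums (2 * (1 / (2 * real N + 1 - 2 * x) ^ (k + 1)))"
        using x by (intro sums_mult negative_binomial_sums) auto
      moreover have "2 * (real ((k + i) choose i) / (2 * real N + 1) ^ (k + i + 1) * (2 * x) ^ i) = b N i * x ^ i"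
        for i
      proof -
        have "(i + k) choose k = (k + i) choose i"
          using binomial_symmetric[of k "i + k"] by (simp add: add.commute)
        then show ?thesis
          unfolding b_def by (simp add: power_mult_distrib add.commute[of k i])
      qed
      ultimately show ?thesis by simp
    qed
    show "\<exists>s. (\<lambda>n. t_trunc (Suc n) k * pochhammer (1 / 2) (Suc n) / (real (Suc n) * pochhammer (1 - x) (Suc n))) sums s
        \<and> (\<lambda>N. 2 / (2 * real N + 1 - 2 * x) ^ (k + 1)) sums s"
      by (rule t_trunc_pochhammer_sums[OF k x])
  qed simp
  then show ?thesis
    by (simp only: a_def b_def)
qed

section \<open>Evaluation by zeta values and return to central binomial coefficients\<close>

lemma odd_zeta_binomial_sums:
  assumes "k \<ge> 1"
  shows "(\<lambda>N. 2 ^ (m + 1) * (real ((m + k) choose k) / (2 * real N + 1) ^ (m + k + 1))) sums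
    (real ((m + k) choose k) * ((2 ^ (m + k + 1) - 1) / 2 ^ k) * zeta (m + k + 1))"
proof -
  have "(\<lambda>N. 2 ^ (m + 1) * real ((m + k) choose k) * (1 / (2 * real N + 1) ^ (m + k + 1))) sums
     (2 ^ (m + 1) * real ((m + k) choose k) * ((1 - 1 / 2 ^ (m + k + 1)) * zeta (m + k + 1)))"
    using assms by (intro sums_mult odd_zeta_sums) simp
  \<comment> \<open>The power of 2 from the substitution combines with the Euler factor of the odd
    zeta sum to give the constant of the theorem.\<close>
  moreover have c: "2 ^ (m + 1) * (1 - 1 / 2 ^ (m + k + 1)) = ((2 ^ (m + k + 1) - 1) / 2 ^ k :: real)"
    by (simp add: power_add field_simps)
  have "2 ^ (m + 1) * b * ((1 - 1 / 2 ^ (m + k + 1)) * z) = b * ((2 ^ (m + k + 1) - 1) / 2 ^ k) * z"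
    for b z :: real
    unfolding c[symmetric] by (simp only: mult_ac)
  ultimately show ?thesis by (simp only: times_divide_eq_right mult_1_right)
qed

lemma binomial_t_zeta_star_sums:
  assumes "k \<ge> 1"
  shows "(\<lambda>n. 1 / 4 ^ Suc n * real ((2 * Suc n) choose Suc n)
      * (t_trunc (Suc n) k * zeta_star_trunc (Suc n) m / real (Suc n))) sums
    (real ((m + k) choose k) * ((2 ^ (m + k + 1) - 1) / 2 ^ k) * zeta (m + k + 1))"
proof -
  have "1 / 4 ^ Suc n * real ((2 * Suc n) choose Suc n) * (t_trunc (Suc n) k * zeta_star_trunc (Suc n) m / real (Suc n))
      = t_trunc (Suc n) k * pochhammer (1 / 2) (Suc n) / (real (Suc n) * fact (Suc n)) * zeta_star_trunc (Suc n) m" for n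
    unfolding central_binomial_pochhammer by (simp add: mult_ac del: fact_Suc of_nat_Suc power_Suc)
  moreover obtain s where s: "(\<lambda>n. t_trunc (Suc n) k * pochhammer (1 / 2) (Suc n) / (real (Suc n) * fact (Suc n)) * zeta_star_trunc (Suc n) m) sums s"
    "(\<lambda>N. 2 ^ (m + 1) * (real ((m + k) choose k) / (2 * real N + 1) ^ (m + k + 1))) sums s"
    using t_zeta_star_sums[OF assms, of m] by blast
  moreover have "s = real ((m + k) choose k) * ((2 ^ (m + k + 1) - 1) / 2 ^ k) * zeta (m + k + 1)"
    by (rule sums_unique2[OF s(2) odd_zeta_binomial_sums[OF assms]])
  ultimately show ?thesis by (simp only:)
qed

lemma binomial_zeta_t_star_sums:
  assumes "m \<ge> 1" "k \<ge> 1"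
  shows "(\<lambda>n. 4 ^ Suc n / real ((2 * Suc n) choose Suc n)
      * (zeta_trunc n (m - 1) * t_star_trunc (Suc n) k / real (Suc n) ^ 2)) sums
    (real ((m + k) choose k) * ((2 ^ (m + k + 1) - 1) / 2 ^ k) * zeta (m + k + 1))"
proof -
  \<comment> \<open>The inverted central binomial contributes \<open>fact (Suc n)\<close>; one of
    the two factors \<open>Suc n\<close> in the denominator reduces it to
    \<open>fact n\<close>.\<close>
  have "4 ^ Suc n / real ((2 * Suc n) choose Suc n) * (zeta_trunc n (m - 1) * t_star_trunc (Suc n) k / real (Suc n) ^ 2)
      = zeta_trunc n (m - 1) * fact n / (real (Suc n) * pochhammer (1 / 2) (Suc n)) * t_star_trunc (Suc n) k" for n
    unfolding central_binomial_pochhammer fact_Suc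
    by (simp add: mult_ac power2_eq_square del: of_nat_Suc power_Suc)
  moreover obtain s where s: "(\<lambda>n. zeta_trunc n (m - 1) * fact n / (real (Suc n) * pochhammer (1 / 2) (Suc n)) * t_star_trunc (Suc n) k) sums s"
    "(\<lambda>N. 2 ^ (m + 1) * (real ((m + k) choose k) / (2 * real N + 1) ^ (m + k + 1))) sums s"
    using zeta_t_star_sums[OF assms(1), of k] by blast
  moreover have "s = real ((m + k) choose k) * ((2 ^ (m + k + 1) - 1) / 2 ^ k) * zeta (m + k + 1)"
    by (rule sums_unique2[OF s(2) odd_zeta_binomial_sums[OF assms(2)]])
  ultimately show ?thesis by (simp only:)
qed

theorem theorem7p1:
  shows "(\<forall>m k :: nat. m \<ge> 1 \<longrightarrow> k \<ge> 1 \<longrightarrow>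
      (let S = real ((m + k) choose k) * ((2 ^ (m + k + 1) - 1) / 2 ^ k) * zeta (m + k + 1);
           f = (\<lambda>n. 4 ^ n / real ((2 * n) choose n)
                  * (zeta_trunc (n - 1) (m - 1) * t_star_trunc n k / real n ^ 2));
           g = (\<lambda>n. 1 / 4 ^ n * real ((2 * n) choose n)
                  * (t_trunc n k * zeta_star_trunc n m / real n))
       in (\<lambda>i. f (Suc i)) sums S \<and> (\<lambda>i. g (Suc i)) sums S))
    \<and> (\<forall>k :: nat. k \<ge> 1 \<longrightarrow>
      (let h = (\<lambda>n. 1 / 4 ^ n * real ((2 * n) choose n) * (t_trunc n k / real n))
       in (\<lambda>i. h (Suc i)) sums ((2 ^ (k + 1) - 1) / 2 ^ k * zeta (k + 1))))"
proof (intro conjI allI impI)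
  fix m k :: nat assume "m \<ge> 1" "k \<ge> 1"
  then show "let S = real ((m + k) choose k) * ((2 ^ (m + k + 1) - 1) / 2 ^ k) * zeta (m + k + 1);
           f = (\<lambda>n. 4 ^ n / real ((2 * n) choose n)
                  * (zeta_trunc (n - 1) (m - 1) * t_star_trunc n k / real n ^ 2));
           g = (\<lambda>n. 1 / 4 ^ n * real ((2 * n) choose n)
                  * (t_trunc n k * zeta_star_trunc n m / real n))
       in (\<lambda>i. f (Suc i)) sums S \<and> (\<lambda>i. g (Suc i)) sums S"
    unfolding Let_def diff_Suc_1
    by (intro conjI binomial_zeta_t_star_sums binomial_t_zeta_star_sums)
next
  fix k :: nat assume "k \<ge> 1"
  \<comment> \<open>At \<open>m = 0\<close> both the star sum and the binomial coefficient are
    1.\<close>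
  from binomial_t_zeta_star_sums[OF this, of 0]
  show "let h = (\<lambda>n. 1 / 4 ^ n * real ((2 * n) choose n) * (t_trunc n k / real n))
       in (\<lambda>i. h (Suc i)) sums ((2 ^ (k + 1) - 1) / 2 ^ k * zeta (k + 1))"
    unfolding Let_def by (simp only: trunc_0 add_0 binomial_n_n of_nat_1 mult_1 mult_1_right)
qed

end
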